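(* Let $n \ge 2$. Then $\Gamma(G_n) \ge 2n-9$. Moreover, $$\Gamma(G_n) \ge \begin{cases} 2n-6, & \text{if } n \equiv 0 \text{ or } 1 \pmod 4,\\ 2n-7, & \text{if } n \equiv 2 \pmod 4,\\ 2n-9, & \text{if } n \equiv 3 \pmod 4.\end{cases}$$
   Context: For a finite simple graph $G$ and $k \in \mathbb{N}$, a $k$-complete coloring of $G$ is a map $c: V(G) \to [k] = \{1,\dots,k\}$ such that for every pair of distinct colors $i \ne j$ in $[k]$ there is an edge $\{u,v\} \in E(G)$ with $c(u)=i$ and $c(v)=j$ (adjacent vertices may receive the same color). The complete coloring number $\Gamma(G)$ is the largest $k$ for which a $k$-complete coloring of $G$ exists. $G_n$ denotes the $n \times n$ square grid graph: vertices $(i,j) \in \mathbb{Z}^2$ with $1 \le i,j \le n$, and $(i_1,j_1) \sim (i_2,j_2)$ iff $|i_1-i_2|+|j_1-j_2| = 1$. *)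

theory Defs
  imports Complex_Main "HOL-Library.FuncSet" "Graph_Theory.Pair_Digraph"
begin

text \<open>
  A finite simple graph is a \<open>pair_graph\<close>: a finite, loop-free digraph whose arc set
  is symmetric. An edge \<open>{u, v}\<close> is represented by the two arcs \<open>(u, v)\<close> and \<open>(v, u)\<close>.
\<close>

definition complete_coloring :: "'a pair_pre_digraph \<Rightarrow> nat \<Rightarrow> ('a \<Rightarrow> nat) \<Rightarrow> bool" where
  "complete_coloring G k c \<longleftrightarrow>
     c \<in> pverts G \<rightarrow> {1..k} \<and>
     (\<forall>i\<in>{1..k}. \<forall>j\<in>{1..k}. i \<noteq> j \<longrightarrow>
        (\<exists>u v. (u, v) \<in> parcs G \<and> c u = i \<and> c v = j))"

text \<open>
  \<open>Max\<close> is meaningful here for finite simple graphs: see \<open>finite_complete_colorings\<close> and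
  \<open>ex_complete_coloring\<close> below.
\<close>

definition complete_coloring_number :: "'a pair_pre_digraph \<Rightarrow> nat" where
  "complete_coloring_number G = Max {k. \<exists>c. complete_coloring G k c}"

definition grid_graph :: "nat \<Rightarrow> (int \<times> int) pair_pre_digraph" where
  "grid_graph n =
     (let V = {1..int n} \<times> {1..int n} in
      \<lparr> pverts = V,
        parcs = {((i\<^sub>1, j\<^sub>1), (i\<^sub>2, j\<^sub>2)) | i\<^sub>1 j\<^sub>1 i\<^sub>2 j\<^sub>2.
                   (i\<^sub>1, j\<^sub>1) \<in> V \<and> (i\<^sub>2, j\<^sub>2) \<in> V \<and> \<bar>i\<^sub>1 - i\<^sub>2\<bar> + \<bar>j\<^sub>1 - j\<^sub>2\<bar> = 1} \<rparr>)"

lemma complete_coloring_le: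
  assumes "pair_wf_digraph G" "finite (pverts G)" "complete_coloring G k c" "k \<ge> 2"
  shows "k \<le> card (pverts G)"
proof -
  have "{1..k} \<subseteq> c ` pverts G"
  proof
    fix i assume i: "i \<in> {1..k}"
    define j where "j = (if i = 1 then 2 else 1::nat)"
    have "j \<in> {1..k}" "i \<noteq> j" using assms(4) by (auto simp: j_def)
    with i assms(3) obtain u v where "(u, v) \<in> parcs G" "c u = i"
      unfolding complete_coloring_def by blast
    then show "i \<in> c ` pverts G"
      using pair_wf_digraph.in_arcsD1[OF assms(1)] by blast
  qed
  then have "card {1..k} \<le> card (c ` pverts G)"
    using assms(2) by (intro card_mono) auto
  also have "\<dots> \<le> card (pverts G)" using assms(2) by (rule card_image_le)
  finally show ?thesis by simp
qed

lemma finite_complete_colorings: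
  assumes "pair_graph G"
  shows "finite {k. \<exists>c. complete_coloring G k c}"
proof -
  interpret pair_graph G by fact
  have "{k. \<exists>c. complete_coloring G k c} \<subseteq> {..max 1 (card (pverts G))}"
  proof clarify
    fix k c assume "complete_coloring G k c"
    then show "k \<le> max 1 (card (pverts G))"
      using complete_coloring_le[OF pair_wf_digraph pair_finite_verts, of k c] by linarith
  qed
  then show ?thesis by (rule finite_subset) simp
qed

lemma ex_complete_coloring: "{k. \<exists>c. complete_coloring G k c} \<noteq> {}"
proof -
  have "complete_coloring G 1 (\<lambda>_. 1)"
    by (auto simp: complete_coloring_def)
  then show ?thesis by blast
qed

lemma pair_graph_grid_graph: "pair_graph (grid_graph n)"
proof
  show "finite (parcs (grid_graph n))"
    by (rule finite_subset[of _ "({1..int n} \<times> {1..int n}) \<times> ({1..int n} \<times> {1..int n})"])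
      (auto simp: grid_graph_def Let_def)
  have "sym (parcs (grid_graph n))"
    by (rule symI) (auto simp: grid_graph_def Let_def abs_minus_commute)
  then show "symmetric (with_proj (grid_graph n))"
    by (simp add: symmetric_def)
qed (auto simp: grid_graph_def Let_def)

end

theory Submission
  imports Defs
begin

text \<open>
  Put \<open>L = n - 1\<close>. The grid is coloured by residues modulo \<open>2L\<close>: each row is a translate of
  the zigzag \<open>0, -1, 1, -2, 2, \<dots>\<close>, with the sign of the zigzag alternating from row to row, and
  the starting values \<open>0, L, 1, L + 1, 2, \<dots>\<close> of the rows move by about half the period at every
  step. Along a row the sum of neighbouring entries takes only two values while their difference
  runs through all distances; two consecutive rows have a constant sum. The horizontal edges in
  two consecutive rows realise all pairs of colours with a given sum \<open>s \<in> {0..<L}\<close>, and the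
  vertical edges between two consecutive rows all pairs with a given sum \<open>s \<in> {L..<2 * L}\<close>. So
  this even gives a complete coloring with \<open>2n - 2\<close> colors.
\<close>

definition zigzag :: "int \<Rightarrow> int" where
  "zigzag j = (if odd j then j div 2 else - (j div 2))"

definition grid_label :: "int \<Rightarrow> int \<times> int \<Rightarrow> int" where
  "grid_label L = (\<lambda>(i, j).
     if odd i then i div 2 + zigzag j else i div 2 - 1 + L - zigzag j)"

text \<open>Labels stay unreduced integers here, so that sums and differences of neighbours are
  exact; reduction modulo \<open>2 * (int n - 1)\<close> enters only in
  \<open>label_adjacent_mod\<close>.\<close>

definition label_adjacent :: "nat \<Rightarrow> int \<Rightarrow> int \<Rightarrow> bool" where
  "label_adjacent n x y \<longleftrightarrow> (\<exists>u v. (u, v) \<in> parcs (grid_graph n) \<and>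
     grid_label (int n - 1) u = x \<and> grid_label (int n - 1) v = y)"

lemma mem_parcs_grid_graph:
  "((i, j), (i', j')) \<in> parcs (grid_graph n) \<longleftrightarrow>
     i \<in> {1..int n} \<and> j \<in> {1..int n} \<and> i' \<in> {1..int n} \<and> j' \<in> {1..int n} \<and>
     \<bar>i - i'\<bar> + \<bar>j - j'\<bar> = 1"
  by (auto simp: grid_graph_def Let_def)

lemma label_adjacent_sym: "label_adjacent n x y \<Longrightarrow> label_adjacent n y x"
  unfolding label_adjacent_def split_paired_Ex mem_parcs_grid_graph
  by (metis abs_minus_commute)

lemma label_adjacent_row:
  assumes "1 \<le> i" "i \<le> int n" "1 \<le> j" "j < int n"
  shows "label_adjacent n (grid_label (int n - 1) (i, j)) (grid_label (int n - 1) (i, j + 1))"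
  unfolding label_adjacent_def using assms
  by (intro exI[of _ "(i, j)"] exI[of _ "(i, j + 1)"]) (auto simp: mem_parcs_grid_graph)

lemma label_adjacent_column:
  assumes "1 \<le> i" "i < int n" "1 \<le> j" "j \<le> int n"
  shows "label_adjacent n (grid_label (int n - 1) (i, j)) (grid_label (int n - 1) (i + 1, j))"
  unfolding label_adjacent_def using assms
  by (intro exI[of _ "(i, j)"] exI[of _ "(i + 1, j)"]) (auto simp: mem_parcs_grid_graph)

lemma zigzag_attains:
  assumes "- int n \<le> 2 * z" "2 * z < int n"
  obtains j where "1 \<le> j" "j \<le> int n" "zigzag j = z"
proof (cases "z \<ge> 0")
  case True
  show ?thesis by (rule that[of "2 * z + 1"]) (use True assms in \<open>auto simp: zigzag_def\<close>)
next
  case False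
  show ?thesis by (rule that[of "- 2 * z"]) (use False assms in \<open>auto simp: zigzag_def\<close>)
qed

text \<open>Of two vertical neighbours the one in the odd row always carries the smaller label, so
  \<open>x\<close> goes into the odd row and \<open>y\<close> into the even one. The bound on
  \<open>y - x\<close> keeps the required zigzag value within the first \<open>n\<close>
  columns.\<close>

lemma label_adjacent_vertical_less:
  assumes "int n - 1 \<le> x + y" "x + y < 2 * (int n - 1)" "x \<le> y" "y - x \<le> 2 * (int n - 1)"
  shows "label_adjacent n x y"
proof -
  \<comment> \<open>The labels in rows \<open>i\<close> and \<open>i + 1\<close> add up to
    \<open>i + int n - 2\<close> in every column, so the sum dictates the row.\<close>
  define i where "i = x + y - int n + 2"
  have i: "1 \<le> i" "i < int n" and y: "y = i + int n - 2 - x" using assms by (auto simp: i_def)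
  show ?thesis
  proof (cases "odd i")
    case True
    then obtain p where p: "i = 2 * p + 1" by (rule oddE)
    have "- int n \<le> 2 * (x - p)" "2 * (x - p) < int n" using assms p y by auto
    then obtain j where "1 \<le> j" "j \<le> int n" "zigzag j = x - p" by (rule zigzag_attains)
    with label_adjacent_column[OF i, of j] show ?thesis
      by (simp add: grid_label_def p y algebra_simps)
  next
    case False
    then obtain p where p: "i = 2 * p" by (auto elim: evenE)
    have "- int n \<le> 2 * (x - p)" "2 * (x - p) < int n" using assms p y by auto
    then obtain j where "1 \<le> j" "j \<le> int n" "zigzag j = x - p" by (rule zigzag_attains)
    with label_adjacent_column[OF i, of j] show ?thesis
      by (intro label_adjacent_sym[of n y x]) (simp add: grid_label_def p y algebra_simps)
  qed
qed

lemma label_adjacent_vertical: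
  assumes "int n - 1 \<le> x + y" "x + y < 2 * (int n - 1)" "\<bar>x - y\<bar> \<le> 2 * (int n - 1)"
  shows "label_adjacent n x y"
proof (cases "x \<le> y")
  case True
  with assms show ?thesis by (intro label_adjacent_vertical_less) auto
next
  case False
  with assms show ?thesis
    by (intro label_adjacent_sym[of n y x] label_adjacent_vertical_less) auto
qed

lemma label_adjacent_horizontal_less:
  assumes "x < y" "y - x < int n" "0 \<le> s" "s < int n - 1"
    and "x + y = s \<or> x + y = s + 2 * (int n - 1)"
  shows "label_adjacent n x y"
proof -
  \<comment> \<open>In every row the entries in columns \<open>j\<close> and \<open>j + 1\<close>
    differ by exactly \<open>j\<close>, so the distance dictates the column.\<close>
  define j where "j = y - x"
  have j: "1 \<le> j" "j < int n" using assms by (auto simp: j_def)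
  have row: "label_adjacent n x y"
    if "1 \<le> i" "i \<le> int n"
      "{grid_label (int n - 1) (i, j), grid_label (int n - 1) (i, j + 1)} = {x, y}" for i
    using label_adjacent_row[OF that(1,2) j] label_adjacent_sym[of n y x] that(3)
    by (auto simp: doubleton_eq_iff)
  \<comment> \<open>The value \<open>c = 0\<close> selects an odd row, \<open>c = int n - 1\<close>
    an even one, whose labels are offset by that amount.\<close>
  obtain c where c: "x + y = s + 2 * c" "c = 0 \<or> c = int n - 1"
    using assms(5) by (metis add_0_right mult_zero_right)
  show ?thesis
  proof (cases "even s")
    case True
    then obtain p where p: "s = 2 * p" by (rule evenE)
    define q where "q = c + p - x"
    have q: "j = 2 * q" "x = c + p - q" "y = c + p + q" using c(1) p by (auto simp: q_def j_def)
    show ?thesis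
      \<comment> \<open>Sum and distance have the same parity. At even \<open>j\<close> the row
        \<open>2 * p + 1\<close> has neighbour sum \<open>2 * p\<close>, and row
        \<open>2 * p + 2\<close> has \<open>2 * p + 2 * (int n - 1)\<close>.\<close>
      by (rule row[of "if c = 0 then 2 * p + 1 else 2 * p + 2"])
        (use assms(3,4) p c(2) in \<open>auto simp: grid_label_def zigzag_def q\<close>)
  next
    case False
    then obtain p where p: "s = 2 * p + 1" by (rule oddE)
    define q where "q = c + p - x"
    have q: "j = 2 * q + 1" "x = c + p - q" "y = c + p + q + 1"
      using c(1) p by (auto simp: q_def j_def)
    have "(2 + 2 * q) div 2 = 1 + q" by simp
    then show ?thesis
      \<comment> \<open>At odd \<open>j\<close> neighbour sums drop by 1 in odd rows and rise by 1
        in even rows. Hence \<open>c = 0\<close> needs the next odd row, which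
        \<open>s < int n - 1\<close> keeps inside the grid.\<close>
      by (intro row[of "if c = 0 then 2 * p + 3 else 2 * p + 2"])
        (use assms(3,4) p c(2) in \<open>auto simp: grid_label_def zigzag_def q\<close>)
  qed
qed

lemma label_adjacent_horizontal:
  assumes "x \<noteq> y" "\<bar>x - y\<bar> < int n" "0 \<le> s" "s < int n - 1"
    and "x + y = s \<or> x + y = s + 2 * (int n - 1)"
  shows "label_adjacent n x y"
proof (cases "x < y")
  case True
  with assms show ?thesis by (intro label_adjacent_horizontal_less[of x y n s]) auto
next
  case False
  with assms show ?thesis
    by (intro label_adjacent_sym[of n y x] label_adjacent_horizontal_less[of y x n s]) auto
qed

text \<open>The residue of \<open>a + b\<close> modulo \<open>2 * L\<close> decides: below
  \<open>L\<close> a horizontal edge serves, otherwise a vertical one. Replacing \<open>a\<close> by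
  \<open>a - 2 * L\<close> brings a vertical sum into its window, or a horizontal distance above
  \<open>L\<close> down below \<open>L\<close>.\<close>

lemma label_adjacent_mod_less:
  assumes "0 \<le> b" "b < a" "a < 2 * (int n - 1)"
  shows "label_adjacent n a b \<or> label_adjacent n (a - 2 * (int n - 1)) b"
proof -
  define L where "L = int n - 1"
  consider "a + b < L" | "L \<le> a + b" "a + b < 2 * L"
    | "2 * L \<le> a + b" "a + b < 3 * L" "a - b \<le> L"
    | "2 * L \<le> a + b" "a + b < 3 * L" "L < a - b" | "3 * L \<le> a + b"
    by linarith
  then show ?thesis
  proof cases
    case 1
    with assms have "label_adjacent n a b"
      by (intro label_adjacent_horizontal[of a b n "a + b"]) (auto simp: L_def)
    then show ?thesis ..
  next
    case 2
    with assms have "label_adjacent n a b"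
      by (intro label_adjacent_vertical) (auto simp: L_def)
    then show ?thesis ..
  next
    case 3
    with assms have "label_adjacent n a b"
      by (intro label_adjacent_horizontal[of a b n "a + b - 2 * L"]) (auto simp: L_def)
    then show ?thesis ..
  next
    case 4
    with assms have "label_adjacent n (a - 2 * (int n - 1)) b"
      by (intro label_adjacent_horizontal[of _ b n "a + b - 2 * L"]) (auto simp: L_def)
    then show ?thesis ..
  next
    case 5
    with assms have "label_adjacent n (a - 2 * (int n - 1)) b"
      by (intro label_adjacent_vertical) (auto simp: L_def)
    then show ?thesis ..
  qed
qed

lemma label_adjacent_mod:
  assumes "0 \<le> a" "a < 2 * (int n - 1)" "0 \<le> b" "b < 2 * (int n - 1)" "a \<noteq> b"
  obtains x y where "label_adjacent n x y"
    "x mod (2 * (int n - 1)) = a" "y mod (2 * (int n - 1)) = b"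
proof -
  have *: "\<exists>x. label_adjacent n x b \<and> x mod (2 * (int n - 1)) = a"
    if "0 \<le> b" "b < a" "a < 2 * (int n - 1)" for a b
  proof -
    have "a mod (2 * (int n - 1)) = a" "(a - 2 * (int n - 1)) mod (2 * (int n - 1)) = a"
      using that by (simp_all add: mod_pos_pos_trivial)
    with label_adjacent_mod_less[OF that] show ?thesis by blast
  qed
  show ?thesis
  proof (cases "b < a")
    case True
    with *[of b a] assms obtain x where "label_adjacent n x b" "x mod (2 * (int n - 1)) = a" by auto
    with assms show ?thesis by (intro that[of x b]) auto
  next
    case False
    with *[of a b] assms obtain y where "label_adjacent n y a" "y mod (2 * (int n - 1)) = b" by auto
    with assms show ?thesis by (intro that[of a y] label_adjacent_sym[of n y a]) auto
  qed
qed

lemma complete_coloring_grid_graph: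
  assumes "n \<ge> 2"
  shows "complete_coloring (grid_graph n) (2 * n - 2)
    (\<lambda>u. 1 + nat (grid_label (int n - 1) u mod (2 * (int n - 1))))"
    (is "complete_coloring _ ?k ?c")
  unfolding complete_coloring_def
proof (intro conjI ballI impI funcsetI)
  fix u
  define r where "r = grid_label (int n - 1) u mod (2 * (int n - 1))"
  have "0 \<le> r" "r < 2 * (int n - 1)"
    unfolding r_def using assms by (intro pos_mod_sign pos_mod_bound; simp)+
  then have "1 + nat r \<in> {1..?k}" by auto
  then show "?c u \<in> {1..?k}" unfolding r_def .
next
  fix i j assume ij: "i \<in> {1..?k}" "j \<in> {1..?k}" "i \<noteq> j"
  then have "0 \<le> int i - 1" "int i - 1 < 2 * (int n - 1)"
    "0 \<le> int j - 1" "int j - 1 < 2 * (int n - 1)" "int i - 1 \<noteq> int j - 1"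
    by auto
  then obtain x y where xy: "label_adjacent n x y"
    "x mod (2 * (int n - 1)) = int i - 1" "y mod (2 * (int n - 1)) = int j - 1"
    by (rule label_adjacent_mod)
  from xy(1) obtain u v where uv: "(u, v) \<in> parcs (grid_graph n)"
    "grid_label (int n - 1) u = x" "grid_label (int n - 1) v = y"
    unfolding label_adjacent_def by blast
  have "?c u = i" "?c v = j" unfolding uv xy using ij by (simp_all add: nat_diff_distrib)
  with uv(1) show "\<exists>u v. (u, v) \<in> parcs (grid_graph n) \<and> ?c u = i \<and> ?c v = j"
    by blast
qed

lemma complete_coloring_number_ge:
  assumes "pair_graph G" "complete_coloring G k c"
  shows "k \<le> complete_coloring_number G"
  unfolding complete_coloring_number_def
  using assms by (intro Max_ge finite_complete_colorings) auto

theorem theorem2: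
  fixes n :: nat
  assumes "n \<ge> 2"
  shows "int (complete_coloring_number (grid_graph n)) \<ge> 2 * int n - 9 \<and>
         int (complete_coloring_number (grid_graph n)) \<ge>
           (if n mod 4 = 0 \<or> n mod 4 = 1 then 2 * int n - 6
            else if n mod 4 = 2 then 2 * int n - 7
            else 2 * int n - 9)"
proof -
  \<comment> \<open>This exceeds each of the required bounds, so one coloring serves all residue
    classes modulo 4.\<close>
  have "2 * n - 2 \<le> complete_coloring_number (grid_graph n)"
    using complete_coloring_number_ge[OF pair_graph_grid_graph complete_coloring_grid_graph[OF assms]] .
  then show ?thesis by auto
qed

end
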